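(* For every integer $s\ge 1$ and every $x\in\mathbb{R}$, $$\Phi_{2s+3}(x)=\frac{x^{2}}{4s(s+1)}\,\Phi_{2s-1}(x)-\frac{2s+1}{2s+2}\,\Phi_{2s+1}(x),$$ and for all $x>0$ the following estimate holds: $$0\le \frac{\Phi_{2s+1}(x)}{\Phi_{2s-1}(x)}<\frac{x^{2}}{2s(2s+1)}.$$
   Context: For an integer $s\ge 0$, $$\Phi_{2s+1}(x):=\frac{1}{2\pi i}\int_{\Gamma_r}\frac{e^{xz}}{(z-1)^{s+1}(z+1)^{s+1}}\,dz,$$ where $\Gamma_r(t)=re^{it}$, $t\in[0,2\pi]$, $r>1$. One has $\Phi_{2s+1}(x)>0$ for all $x>0$. *)

theory Defs
  imports "HOL-Complex_Analysis.Complex_Analysis" "HOL-Library.Complex_Order"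
begin

text \<open>
  \<open>Phi_odd r s x\<close> is \<open>\<Phi>\<close> with subscript \<open>2s+1\<close> at \<open>x\<close>, computed on the circle of radius \<open>r\<close>
  about \<open>0\<close>; only \<open>r > 1\<close> is meaningful, and then the value does not depend on \<open>r\<close>.
  \<open>circlepath 0 r\<close> is \<open>t \<mapsto> r e\<^sup>i\<^sup>t\<close>, \<open>t \<in> [0, 2\<pi>]\<close>, rescaled to the unit interval.
\<close>

definition Phi_odd :: "real \<Rightarrow> nat \<Rightarrow> real \<Rightarrow> complex" where
  "Phi_odd r s x = 1 / (2 * of_real pi * \<i>) *
     contour_integral (circlepath 0 r)
       (\<lambda>z. exp (of_real x * z) / ((z - 1) ^ (s + 1) * (z + 1) ^ (s + 1)))"

text \<open>
  Values are complex. Inequalities between them use the order of \<open>Complex_Order\<close>, in which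
  \<open>a \<le> b\<close> and \<open>a < b\<close> require \<open>Im a = Im b\<close>. A bound against a real number thus also asserts
  that the bounded quantity is real.
\<close>

end

theory Submission imports Defs
begin

text \<open>
  Write \<open>I\<^sub>n\<close> and \<open>J\<^sub>n\<close> for the integrals of \<open>exp (xz) / (z\<^sup>2 - 1)\<^sup>n\<close> and
  \<open>z exp (xz) / (z\<^sup>2 - 1)\<^sup>n\<close> over the circle. The derivatives of \<open>exp (xz) / (z\<^sup>2 - 1)\<^sup>n\<close> and
  \<open>z exp (xz) / (z\<^sup>2 - 1)\<^sup>n\<close> integrate to zero, which gives \<open>x I\<^sub>n = 2n J\<^sub>n\<^sub>+\<^sub>1\<close> and
  \<open>2n I\<^sub>n\<^sub>+\<^sub>1 = (1 - 2n) I\<^sub>n + x J\<^sub>n\<close>, hence the recurrence. With the residues \<open>sinh x\<close> and \<open>cosh x\<close> for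
  \<open>n = 1\<close>, it identifies \<open>\<Phi>\<close> with a real sequence \<open>f\<^sub>s\<close> for which \<open>f\<^sub>s\<^sub>+\<^sub>1' = x f\<^sub>s / (2 (s + 1))\<close>
  and \<open>f\<^sub>s 0 = 0\<close>, so that \<open>f\<^sub>s > 0\<close> on the positive axis by induction. The upper bound for the
  ratio is the positivity of the left-hand side of the recurrence.
\<close>

section \<open>A real sequence with the values of the contour integrals\<close>

text \<open>For x > 0 this is a scaled modified Bessel function: sqrt(pi/2) x^(s + 1/2) I_(s +
  1/2)(x) / (2^s s!).\<close>

fun Phi_real :: "nat \<Rightarrow> real \<Rightarrow> real" where
  "Phi_real 0 x = sinh x"
| "Phi_real (Suc 0) x = (x * cosh x - sinh x) / 2"
| "Phi_real (Suc (Suc s)) x = x\<^sup>2 / (4 * (real s + 1) * (real s + 2)) * Phi_real s x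
     - (2 * real s + 3) / (2 * real s + 4) * Phi_real (Suc s) x"

lemma Phi_real_at_0: "Phi_real s 0 = 0"
  by (induction s "0::real" rule: Phi_real.induct) auto

text \<open>By two-step induction, differentiating the recurrence for index s + 3 leaves multiples
  of \<open>x * Phi_real (Suc s) x\<close> and \<open>x ^ 3 * Phi_real s x\<close>. The recurrence
  one index lower (\<open>rec\<close>) combines them into a multiple of
  \<open>x * Phi_real (Suc (Suc s)) x\<close>.\<close>

lemma DERIV_Phi_real_Suc:
  "(Phi_real (Suc s) has_real_derivative x * Phi_real s x / (2 * (real s + 1))) (at x)"
proof (induction s rule: induct_nat_012)
  case 0
  have "((\<lambda>x. (x * cosh x - sinh x) / 2) has_real_derivative x * sinh x / 2) (at x)"
    by (auto intro!: derivative_eq_intros)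
  then show ?case by simp
next
  case 1
  have "((\<lambda>x. x\<^sup>2 / 8 * sinh x - 3 / 4 * ((x * cosh x - sinh x) / 2)) has_real_derivative
     x * ((x * cosh x - sinh x) / 2) / 4) (at x)"
    by (auto intro!: derivative_eq_intros simp: field_simps power2_eq_square)
  then show ?case by simp
next
  case (ge2 s)
  define a where "a = real s + 1"
  have a: "a > 0" by (simp add: a_def)
  have IH: "(Phi_real (Suc s) has_real_derivative x * Phi_real s x / (2 * a)) (at x)"
    "(Phi_real (Suc (Suc s)) has_real_derivative x * Phi_real (Suc s) x / (2 * (a + 1))) (at x)"
    using ge2 by (simp_all add: a_def add_ac del: Phi_real.simps)
  define c d where "c = 1 / (4 * (a + 1) * (a + 2))" and "d = (2 * a + 3) / (2 * a + 4)"
  have "Phi_real (Suc (Suc (Suc s))) = (\<lambda>x. c * x\<^sup>2 * Phi_real (Suc s) x - d * Phi_real (Suc (Suc s)) x)"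
    by (auto simp: a_def c_def d_def fun_eq_iff add_ac)
  moreover have rec: "Phi_real (Suc (Suc s)) x = x\<^sup>2 / (4 * a * (a + 1)) * Phi_real s x
     - (2 * a + 1) / (2 * a + 2) * Phi_real (Suc s) x"
    by (simp add: a_def add_ac)
  ultimately have "(Phi_real (Suc (Suc (Suc s))) has_real_derivative
      c * (2 * x) * Phi_real (Suc s) x + c * x\<^sup>2 * (x * Phi_real s x / (2 * a))
      - d * (x * Phi_real (Suc s) x / (2 * (a + 1)))) (at x)"
    by (auto intro!: derivative_eq_intros IH simp: algebra_simps simp del: Phi_real.simps)
  also have "c * (2 * x) * Phi_real (Suc s) x + c * x\<^sup>2 * (x * Phi_real s x / (2 * a))
      - d * (x * Phi_real (Suc s) x / (2 * (a + 1))) = x * Phi_real (Suc (Suc s)) x / (2 * (a + 2))"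
    using a unfolding rec c_def d_def by (simp add: divide_simps) algebra
  finally show ?case by (simp add: a_def add_ac)
qed

lemma Phi_real_pos:
  assumes "x > 0"
  shows "Phi_real s x > 0"
  using assms
proof (induction s arbitrary: x)
  case 0
  then show ?case by simp
next
  case (Suc s)
  have "Phi_real (Suc s) 0 < Phi_real (Suc s) x"
  \<comment> \<open>The derivative vanishes at 0, so its positivity is available only on the open
    interval.\<close>
  proof (rule DERIV_pos_imp_increasing_open[where f = "Phi_real (Suc s)"])
    show "\<exists>y. (Phi_real (Suc s) has_real_derivative y) (at t) \<and> y > 0" if "0 < t" "t < x" for t
      using that Suc.IH[of t] DERIV_Phi_real_Suc[of s t]
      by (intro exI[of _ "t * Phi_real s t / (2 * (real s + 1))"]) auto
    show "continuous_on {0..x} (Phi_real (Suc s))"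
      using DERIV_Phi_real_Suc by (meson DERIV_isCont continuous_at_imp_continuous_on)
  qed (use Suc in auto)
  then show ?case by (simp only: Phi_real_at_0)
qed

section \<open>Contour integrals and their recurrences\<close>

definition exp_integral :: "real \<Rightarrow> complex \<Rightarrow> nat \<Rightarrow> complex" where
  "exp_integral r x n = contour_integral (circlepath 0 r) (\<lambda>z. exp (x * z) / (z\<^sup>2 - 1) ^ n)"

definition exp_integral' :: "real \<Rightarrow> complex \<Rightarrow> nat \<Rightarrow> complex" where
  "exp_integral' r x n = contour_integral (circlepath 0 r) (\<lambda>z. z * exp (x * z) / (z\<^sup>2 - 1) ^ n)"

text \<open>The third argument of \<open>exp_integral\<close> is the exponent itself, hence the
  shift from s to s + 1.\<close>

lemma Phi_odd_conv_exp_integral: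
  "Phi_odd r s x = exp_integral r (of_real x) (s + 1) / (2 * of_real pi * \<i>)"
proof -
  have "(z - 1) ^ (s + 1) * (z + 1) ^ (s + 1) = (z\<^sup>2 - 1) ^ (s + 1)" for z :: complex
    by (simp only: power_mult_distrib [symmetric]) (simp add: power2_eq_square algebra_simps)
  then show ?thesis
    by (simp only: Phi_odd_def exp_integral_def) simp
qed

context
  fixes r :: real and x :: complex
  assumes r: "r > 1"
begin

lemma square_neq_1_on_circle: "z\<^sup>2 - 1 \<noteq> 0" if "z \<in> path_image (circlepath 0 r)" for z :: complex
  using that r by (auto simp: power2_eq_1_iff)

lemma has_contour_integral_exp_integral:
  "((\<lambda>z. exp (x * z) / (z\<^sup>2 - 1) ^ n) has_contour_integral exp_integral r x n) (circlepath 0 r)"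
  unfolding exp_integral_def
  by (intro has_contour_integral_integral contour_integrable_continuous_circlepath
      continuous_intros ballI power_not_zero square_neq_1_on_circle)

lemma has_contour_integral_exp_integral':
  "((\<lambda>z. z * exp (x * z) / (z\<^sup>2 - 1) ^ n) has_contour_integral exp_integral' r x n) (circlepath 0 r)"
  unfolding exp_integral'_def
  by (intro has_contour_integral_integral contour_integrable_continuous_circlepath
      continuous_intros ballI power_not_zero square_neq_1_on_circle)

text \<open>The circle is closed and a primitive is needed only along it, so the poles inside do no
  harm.\<close>

lemma has_contour_integral_derivative_circlepath:
  assumes "\<And>z. z \<in> path_image (circlepath 0 r) \<Longrightarrow> (f has_field_derivative f' z) (at z)"
  shows "(f' has_contour_integral 0) (circlepath 0 r)"
  by (rule Cauchy_theorem_primitive[of "path_image (circlepath 0 r)" f])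
     (auto intro: has_field_derivative_at_within[OF assms] simp del: path_image_circlepath)

lemma DERIV_inverse_power_square_minus_1:
  fixes z :: complex
  assumes "z\<^sup>2 - 1 \<noteq> 0"
  shows "((\<lambda>z. 1 / (z\<^sup>2 - 1) ^ n) has_field_derivative - (2 * of_nat n * z / (z\<^sup>2 - 1) ^ Suc n)) (at z)"
proof (cases n)
  case (Suc m)
  define w where "w = z\<^sup>2 - 1"
  have "((\<lambda>z. 1 / (z\<^sup>2 - 1) ^ n) has_field_derivative
      - (of_nat n * (2 * z) * w ^ m) / (w ^ n * w ^ n)) (at z)"
    using assms unfolding w_def
    by (auto intro!: derivative_eq_intros simp: Suc simp del: power_Suc)
  also have "- (of_nat n * (2 * z) * w ^ m) / (w ^ n * w ^ n) = - (2 * of_nat n * z / w ^ Suc n)"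
    using assms by (simp add: Suc w_def [symmetric] divide_simps)
  finally show ?thesis by (simp only: w_def)
qed auto

lemma exp_integral'_Suc: "2 * of_nat n * exp_integral' r x (Suc n) = x * exp_integral r x n"
proof -
  let ?h = "\<lambda>z. x * (exp (x * z) / (z\<^sup>2 - 1) ^ n) - 2 * of_nat n * (z * exp (x * z) / (z\<^sup>2 - 1) ^ Suc n)"
  have "(?h has_contour_integral 0) (circlepath 0 r)"
  proof (rule has_contour_integral_derivative_circlepath)
    fix z assume "z \<in> path_image (circlepath 0 r)"
    then have nz: "z\<^sup>2 - 1 \<noteq> 0" by (rule square_neq_1_on_circle)
    show "((\<lambda>z. exp (x * z) / (z\<^sup>2 - 1) ^ n) has_field_derivative ?h z) (at z)"
      using DERIV_mult[OF DERIV_chain'[OF DERIV_cmult_Id DERIV_exp] DERIV_inverse_power_square_minus_1[OF nz], of x n]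
      by (simp add: algebra_simps)
  qed
  moreover have "(?h has_contour_integral
      (x * exp_integral r x n - 2 * of_nat n * exp_integral' r x (Suc n))) (circlepath 0 r)"
    by (intro has_contour_integral_diff has_contour_integral_lmul
        has_contour_integral_exp_integral has_contour_integral_exp_integral')
  ultimately show ?thesis
    using has_contour_integral_unique by force
qed

text \<open>Differentiating the denominator produces the numerator 2n z^2. Writing it as 2n (z^2 -
  1) + 2n splits it between the exponents n and n + 1, whence the coefficient 1 - 2n.\<close>

lemma exp_integral_Suc:
  "2 * of_nat n * exp_integral r x (Suc n) = (1 - 2 * of_nat n) * exp_integral r x n + x * exp_integral' r x n"
proof -
  let ?h = "\<lambda>z. (1 - 2 * of_nat n) * (exp (x * z) / (z\<^sup>2 - 1) ^ n) + x * (z * exp (x * z) / (z\<^sup>2 - 1) ^ n)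
      - 2 * of_nat n * (exp (x * z) / (z\<^sup>2 - 1) ^ Suc n)"
  have "(?h has_contour_integral 0) (circlepath 0 r)"
  proof (rule has_contour_integral_derivative_circlepath)
    fix z assume "z \<in> path_image (circlepath 0 r)"
    then have nz: "z\<^sup>2 - 1 \<noteq> 0" by (rule square_neq_1_on_circle)
    show "((\<lambda>z. z * exp (x * z) / (z\<^sup>2 - 1) ^ n) has_field_derivative ?h z) (at z)"
      using DERIV_mult[OF DERIV_mult[OF DERIV_ident DERIV_chain'[OF DERIV_cmult_Id DERIV_exp]]
          DERIV_inverse_power_square_minus_1[OF nz], of x n] nz
      by (simp add: divide_simps) (simp add: algebra_simps power2_eq_square)
  qed
  moreover have "(?h has_contour_integral
      ((1 - 2 * of_nat n) * exp_integral r x n + x * exp_integral' r x n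
        - 2 * of_nat n * exp_integral r x (Suc n))) (circlepath 0 r)"
    by (intro has_contour_integral_diff has_contour_integral_add has_contour_integral_lmul
        has_contour_integral_exp_integral has_contour_integral_exp_integral')
  ultimately show ?thesis
    using has_contour_integral_unique by force
qed

lemma Cauchy_exp_circlepath:
  assumes "norm w = 1"
  shows "((\<lambda>z. exp (x * z) / (z - w)) has_contour_integral 2 * of_real pi * \<i> * exp (x * w)) (circlepath 0 r)"
  by (rule Cauchy_integral_circlepath_simple) (use r assms in \<open>auto intro!: holomorphic_intros\<close>)

lemma exp_integral_1: "exp_integral r x 1 = 2 * of_real pi * \<i> * sinh x"
proof -
  \<comment> \<open>Partial fractions: 1 / (z^2 - 1) = (1 / (z - 1) - 1 / (z + 1)) / 2. The form
    \<open>z - (-1)\<close> matches Cauchy's formula at w = -1.\<close>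
  have "((\<lambda>z. (exp (x * z) / (z - 1) - exp (x * z) / (z - (-1))) / 2) has_contour_integral
     (2 * of_real pi * \<i> * exp (x * 1) - 2 * of_real pi * \<i> * exp (x * (-1))) / 2) (circlepath 0 r)"
    by (intro has_contour_integral_div has_contour_integral_diff Cauchy_exp_circlepath) auto
  then have "((\<lambda>z. exp (x * z) / (z\<^sup>2 - 1) ^ 1) has_contour_integral
     (2 * of_real pi * \<i> * exp (x * 1) - 2 * of_real pi * \<i> * exp (x * (-1))) / 2) (circlepath 0 r)"
  proof (rule has_contour_integral_eq)
    fix z assume "z \<in> path_image (circlepath 0 r)"
    then have "z\<^sup>2 - 1 \<noteq> 0" by (rule square_neq_1_on_circle)
    then have "z \<noteq> 1" "z + 1 \<noteq> 0" "z\<^sup>2 - 1 = (z - 1) * (z + 1)"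
      by (auto simp: power2_eq_1_iff add_eq_0_iff2 square_diff_one_factored power2_eq_square mult.commute)
    then show "(exp (x * z) / (z - 1) - exp (x * z) / (z - (-1))) / 2 = exp (x * z) / (z\<^sup>2 - 1) ^ 1"
      by (simp add: divide_simps) (simp add: algebra_simps)
  qed
  from has_contour_integral_unique[OF has_contour_integral_exp_integral this]
  show ?thesis by (simp add: sinh_field_def algebra_simps)
qed

lemma exp_integral'_1: "exp_integral' r x 1 = 2 * of_real pi * \<i> * cosh x"
proof -
  \<comment> \<open>Here z / (z^2 - 1) = (1 / (z - 1) + 1 / (z + 1)) / 2.\<close>
  have "((\<lambda>z. (exp (x * z) / (z - 1) + exp (x * z) / (z - (-1))) / 2) has_contour_integral
     (2 * of_real pi * \<i> * exp (x * 1) + 2 * of_real pi * \<i> * exp (x * (-1))) / 2) (circlepath 0 r)"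
    by (intro has_contour_integral_div has_contour_integral_add Cauchy_exp_circlepath) auto
  then have "((\<lambda>z. z * exp (x * z) / (z\<^sup>2 - 1) ^ 1) has_contour_integral
     (2 * of_real pi * \<i> * exp (x * 1) + 2 * of_real pi * \<i> * exp (x * (-1))) / 2) (circlepath 0 r)"
  proof (rule has_contour_integral_eq)
    fix z assume "z \<in> path_image (circlepath 0 r)"
    then have "z\<^sup>2 - 1 \<noteq> 0" by (rule square_neq_1_on_circle)
    then have "z \<noteq> 1" "z + 1 \<noteq> 0" "z\<^sup>2 - 1 = (z - 1) * (z + 1)"
      by (auto simp: power2_eq_1_iff add_eq_0_iff2 square_diff_one_factored power2_eq_square mult.commute)
    then show "(exp (x * z) / (z - 1) + exp (x * z) / (z - (-1))) / 2 = z * exp (x * z) / (z\<^sup>2 - 1) ^ 1"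
      by (simp add: divide_simps) (simp add: algebra_simps)
  qed
  from has_contour_integral_unique[OF has_contour_integral_exp_integral' this]
  show ?thesis by (simp add: cosh_field_def algebra_simps)
qed

text \<open>Eliminating \<open>exp_integral'\<close> at exponent n + 2 from the two relations above
  leaves a three-term recurrence with the coefficients of \<open>Phi_real\<close>.\<close>

lemma exp_integral_recurrence:
  "exp_integral r x (Suc (Suc (Suc n))) =
     x\<^sup>2 / (4 * (of_nat n + 1) * (of_nat n + 2)) * exp_integral r x (Suc n)
     - (2 * of_nat n + 3) / (2 * of_nat n + 4) * exp_integral r x (Suc (Suc n))"
proof -
  define a :: complex where "a = of_nat n + 1"
  \<comment> \<open>As images of successors these complex numbers are nonzero, which permits the
    later divisions.\<close>
  have "a = of_nat (Suc n)" "a + 1 = of_nat (Suc (Suc n))" "2 * a + 2 = of_nat (Suc (Suc (Suc (Suc (2 * n)))))"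
    by (simp_all add: a_def)
  then have nz: "a \<noteq> 0" "a + 1 \<noteq> 0" "2 * a + 2 \<noteq> 0" by (simp_all only: of_nat_eq_0_iff)
  have J: "2 * a * exp_integral' r x (Suc (Suc n)) = x * exp_integral r x (Suc n)"
    using exp_integral'_Suc[of "Suc n"] by (simp add: a_def add_ac)
  have "2 * (a + 1) * exp_integral r x (Suc (Suc (Suc n))) =
    (1 - 2 * (a + 1)) * exp_integral r x (Suc (Suc n)) + x * exp_integral' r x (Suc (Suc n))"
    using exp_integral_Suc[of "Suc (Suc n)"] by (simp add: a_def add_ac)
  then have "4 * a * (a + 1) * exp_integral r x (Suc (Suc (Suc n))) =
    x\<^sup>2 * exp_integral r x (Suc n) - 2 * a * (2 * a + 1) * exp_integral r x (Suc (Suc n))"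
    using J by algebra
  then have "exp_integral r x (Suc (Suc (Suc n))) =
    x\<^sup>2 / (4 * a * (a + 1)) * exp_integral r x (Suc n)
     - (2 * a + 1) / (2 * (a + 1)) * exp_integral r x (Suc (Suc n))"
    using nz by (simp add: divide_simps) algebra
  then show ?thesis by (simp add: a_def add_ac)
qed

end

section \<open>Identification with the real sequence and the final estimate\<close>

lemma exp_integral_conv_Phi_real:
  assumes "r > 1"
  shows "exp_integral r (of_real x) (Suc s) = 2 * of_real pi * \<i> * of_real (Phi_real s x)"
proof (induction s rule: induct_nat_012)
  case 0
  show ?case using exp_integral_1[OF assms, of "of_real x"]
    by (simp add: sinh_field_def flip: exp_of_real)
next
  case 1
  show ?case
    \<comment> \<open>At exponent 1 the relation reads 2 I_2 = x J_1 - I_1, so both residues enter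
      the second initial value.\<close>
    using exp_integral_Suc[OF assms, of 1 "of_real x"]
    unfolding exp_integral_1[OF assms] exp_integral'_1[OF assms]
    by (simp add: sinh_field_def cosh_field_def field_simps flip: exp_of_real)
next
  case (ge2 s)
  then show ?case
    by (simp add: exp_integral_recurrence[OF assms] algebra_simps)
qed

lemma Phi_odd_conv_Phi_real: "r > 1 \<Longrightarrow> Phi_odd r s x = of_real (Phi_real s x)"
  using exp_integral_conv_Phi_real[of r x s] by (simp add: Phi_odd_conv_exp_integral)

theorem corollary10:
  fixes r :: real and s :: nat
  assumes "r > 1" and "s \<ge> 1"
  shows "(\<forall>x::real. Phi_odd r (s + 1) x =
             of_real (x\<^sup>2 / (4 * real s * (real s + 1))) * Phi_odd r (s - 1) x
             - of_real ((2 * real s + 1) / (2 * real s + 2)) * Phi_odd r s x) \<and>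
         (\<forall>x::real. x > 0 \<longrightarrow>
             0 \<le> Phi_odd r s x / Phi_odd r (s - 1) x \<and>
             Phi_odd r s x / Phi_odd r (s - 1) x < of_real (x\<^sup>2 / (2 * real s * (2 * real s + 1))))"
proof -
  \<comment> \<open>With s = n + 1 the truncated difference \<open>s - 1\<close> is n, and
    \<open>rec\<close> is the defining clause of \<open>Phi_real\<close> at n.\<close>
  from assms(2) obtain n where s: "s = Suc n" by (cases s) auto
  have rec: "Phi_real (s + 1) x = x\<^sup>2 / (4 * real s * (real s + 1)) * Phi_real (s - 1) x
      - (2 * real s + 1) / (2 * real s + 2) * Phi_real s x" for x
    by (simp add: s add_ac)
  have bounds: "0 \<le> Phi_real s x / Phi_real (s - 1) x \<and>
      Phi_real s x / Phi_real (s - 1) x < x\<^sup>2 / (2 * real s * (2 * real s + 1))"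
    if "x > 0" for x
  proof
    note pos = Phi_real_pos[OF that]
    show "0 \<le> Phi_real s x / Phi_real (s - 1) x"
      using pos[of s] pos[of "s - 1"] by simp
    have a: "real s > 0" using assms(2) by simp
    have "(2 * real s + 1) / (2 * real s + 2) * Phi_real s x
        < x\<^sup>2 / (4 * real s * (real s + 1)) * Phi_real (s - 1) x"
      using pos[of "s + 1"] unfolding rec by linarith
    \<comment> \<open>The factor (2s + 1) / (2s + 2) is pulled out so that it cancels from both
      sides.\<close>
    also have "x\<^sup>2 / (4 * real s * (real s + 1)) * Phi_real (s - 1) x
        = (2 * real s + 1) / (2 * real s + 2) * (x\<^sup>2 / (2 * real s * (2 * real s + 1)) * Phi_real (s - 1) x)"
      using a by (simp add: divide_simps)
    finally have "Phi_real s x < x\<^sup>2 / (2 * real s * (2 * real s + 1)) * Phi_real (s - 1) x"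
      using a by (subst (asm) mult_less_cancel_left_pos) auto
    then show "Phi_real s x / Phi_real (s - 1) x < x\<^sup>2 / (2 * real s * (2 * real s + 1))"
      using pos[of "s - 1"] by (simp only: pos_divide_less_eq)
  qed
  show ?thesis
  proof (intro conjI allI impI)
    fix x :: real
    show "Phi_odd r (s + 1) x =
             of_real (x\<^sup>2 / (4 * real s * (real s + 1))) * Phi_odd r (s - 1) x
             - of_real ((2 * real s + 1) / (2 * real s + 2)) * Phi_odd r s x"
      unfolding Phi_odd_conv_Phi_real[OF assms(1)] rec by (simp only: of_real_diff of_real_mult)
  next
    fix x :: real assume "x > 0"
    from bounds[OF this] show "0 \<le> Phi_odd r s x / Phi_odd r (s - 1) x"
      "Phi_odd r s x / Phi_odd r (s - 1) x < of_real (x\<^sup>2 / (2 * real s * (2 * real s + 1)))"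
      \<comment> \<open>Once the quotient is a single \<open>of_real\<close>, the imaginary parts
        agree and the complex order reduces to the real one.\<close>
      unfolding Phi_odd_conv_Phi_real[OF assms(1)] of_real_divide [symmetric]
      by (simp_all add: less_eq_complex_def less_complex_def del: of_real_divide)
  qed
qed

end
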